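(* Let $f_D$ be a random mechanism that satisfies $\theta$-Rao differential privacy for some $\theta$, and let $\varphi$ be an arbitrary random function. Then $\varphi\circ f_D$ also satisfies $\theta$-Rao differential privacy, with the same $\theta$.
   Context: Datasets: $D=\{x_1,\dots,x_n\}$ with $x_i\in\mathcal{X}$. Two datasets $D,D'$ are adjacent, written $D\sim D'$, if $|D|=|D'|$ and they differ in exactly one observation. A random mechanism assigns to each dataset $D$ a probability density $f_D$ describing the distribution of the released output; the densities $f_D$ belong to a parametric family $\{p(\cdot;\xi):\xi\in\Xi\}$, $\Xi\subset\mathbb{R}^k$, so that $f_D=p(\cdot;\xi(D))$ for some parameter $\xi(D)\in\Xi$. Rao distance: let $\{p(\cdot;\xi):\xi\in\Xi\}$ be a parametric family of probability densities with respect to a base measure, each density being identified by its parameter. The family is assumed to satisfy the usual regularity conditions: the partial derivatives $\partial p(x;\xi)/\partial\xi_i$ exist almost everywhere, integration and differentiation can be interchanged (so $\int \partial p(x;\xi)/\partial\xi_i\,dx=0$), the support of $p(\cdot;\xi)$ does not depend on $\xi$, and the Fisher information matrix $$g_{ij}(\xi)=\mathbb{E}_{x\sim p(\cdot;\xi)}\left[\frac{\partial\ln p(x;\xi)}{\partial\xi_i}\frac{\partial\ln p(x;\xi)}{\partial\xi_j}\right]$$ is symmetric positive definite. Regard $g$ as a Riemannian metric on $\Xi$. The Rao distance $d_R(p(\cdot;\xi_1),p(\cdot;\xi_2))$ is the Riemannian distance between $\xi_1$ and $\xi_2$, i.e. the infimum of $\int_0^1\big(\sum_{i,j}g_{ij}(\alpha(t))\dot\alpha_i(t)\dot\alpha_j(t)\big)^{1/2}dt$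 over smooth paths $\alpha:[0,1]\to\Xi$ with $\alpha(0)=\xi_1$, $\alpha(1)=\xi_2$. Rao differential privacy: a mechanism $f_D$ satisfies $\theta$-Rao differential privacy if $d_R(f_D,f_{D'})\le\theta$ for all $D\sim D'$, where $\theta$ is a pre-specified parameter (the privacy budget). Post-processing: a random function $\varphi$ is a (deterministic or randomized) map applied to the output of the mechanism, which does not depend on the dataset except through that output. $\varphi\circ f_D$ denotes the mechanism whose output is $\varphi$ applied to a draw from $f_D$. Its density is $q(\cdot;\xi(D))$, where $q(\cdot;\xi)$ denotes the density of $\varphi$ applied to a draw from $p(\cdot;\xi)$; its Rao distance is the one of the family $\{q(\cdot;\xi):\xi\in\Xi\}$, defined in the same way. *)

theory Defs
  imports "HOL-Probability.Probability" "HOL-Library.Multiset"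
begin

section \<open>Datasets\<close>

text \<open>Observations may repeat and are unordered, so a dataset is a finite multiset.\<close>

definition datasets :: "'d set \<Rightarrow> 'd multiset set" where
  "datasets \<X> = {D. set_mset D \<subseteq> \<X>}"

definition adjacent :: "'d multiset \<Rightarrow> 'd multiset \<Rightarrow> bool" where
  "adjacent D D' \<longleftrightarrow> size D = size D' \<and> size (D - D') = 1"

section \<open>Parametric families of densities\<close>

text \<open>
  A family is given by a base measure \<open>M\<close>, a parameter set \<open>\<Xi>\<close> and a function \<open>p\<close>, where
  \<open>p \<xi> x\<close> is the density at \<open>x\<close> of the member with parameter \<open>\<xi>\<close>. Only the values with
  \<open>\<xi> \<in> \<Xi>\<close> are meaningful.
\<close>

definition density_family ::
    "'x measure \<Rightarrow> (real^'k) set \<Rightarrow> (real^'k \<Rightarrow> 'x \<Rightarrow> real) \<Rightarrow> bool" where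
  "density_family M \<Xi> p \<longleftrightarrow>
     (\<forall>\<xi>\<in>\<Xi>. p \<xi> \<in> borel_measurable M \<and> (\<forall>x\<in>space M. 0 \<le> p \<xi> x) \<and>
            (\<integral>\<^sup>+x. ennreal (p \<xi> x) \<partial>M) = 1)"

definition partial_deriv :: "'k::finite \<Rightarrow> (real^'k \<Rightarrow> real) \<Rightarrow> real^'k \<Rightarrow> real" where
  "partial_deriv i f \<xi> = deriv (\<lambda>t. f (\<xi> + t *\<^sub>R axis i 1)) 0"

definition partials_exist_AE ::
    "'x measure \<Rightarrow> (real^'k) set \<Rightarrow> (real^'k \<Rightarrow> 'x \<Rightarrow> real) \<Rightarrow> bool" where
  "partials_exist_AE M \<Xi> p \<longleftrightarrow>
     (\<forall>\<xi>\<in>\<Xi>. \<forall>i. AE x in M. (\<lambda>t. p (\<xi> + t *\<^sub>R axis i 1) x) differentiable (at 0))"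

text \<open>
  Integration and differentiation can be interchanged: the expectation of every bounded statistic
  \<open>T\<close> may be differentiated under the integral sign (\<open>T = 1\<close> gives that the partial derivatives of
  the density integrate to 0, \<open>T\<close> an indicator gives the derivatives of the probabilities of events).
  Partial derivatives are only defined almost everywhere; integrating them over the completion
  makes the integral insensitive to their values on a null set.
\<close>

definition diff_under_integral ::
    "'x measure \<Rightarrow> (real^'k) set \<Rightarrow> (real^'k \<Rightarrow> 'x \<Rightarrow> real) \<Rightarrow> bool" where
  "diff_under_integral M \<Xi> p \<longleftrightarrow>
     (\<forall>\<xi>\<in>\<Xi>. \<forall>i.
        integrable (completion M) (\<lambda>x. partial_deriv i (\<lambda>\<eta>. p \<eta> x) \<xi>) \<and>
        (\<forall>T\<in>borel_measurable M. bounded (T ` space M) \<longrightarrow>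
           ((\<lambda>t. \<integral>x. T x * p (\<xi> + t *\<^sub>R axis i 1) x \<partial>M) has_real_derivative
            (\<integral>x. T x * partial_deriv i (\<lambda>\<eta>. p \<eta> x) \<xi> \<partial>completion M)) (at 0)))"

definition common_support ::
    "'x measure \<Rightarrow> (real^'k) set \<Rightarrow> (real^'k \<Rightarrow> 'x \<Rightarrow> real) \<Rightarrow> bool" where
  "common_support M \<Xi> p \<longleftrightarrow>
     (\<forall>\<xi>\<in>\<Xi>. \<forall>\<eta>\<in>\<Xi>. {x\<in>space M. p \<xi> x \<noteq> 0} = {x\<in>space M. p \<eta> x \<noteq> 0})"

section \<open>Fisher information\<close>

definition score :: "(real^'k::finite \<Rightarrow> 'x \<Rightarrow> real) \<Rightarrow> real^'k \<Rightarrow> 'k \<Rightarrow> 'x \<Rightarrow> real" where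
  "score p \<xi> i x = partial_deriv i (\<lambda>\<eta>. ln (p \<eta> x)) \<xi>"

text \<open>
  The law of \<open>x \<sim> p \<xi>\<close>, completed because the score is only defined almost everywhere. In
  particular the value of the score where \<open>p \<xi> x = 0\<close> is irrelevant.
\<close>

definition law ::
    "'x measure \<Rightarrow> (real^'k \<Rightarrow> 'x \<Rightarrow> real) \<Rightarrow> real^'k \<Rightarrow> 'x measure" where
  "law M p \<xi> = completion (density M (\<lambda>x. ennreal (p \<xi> x)))"

definition fisher_info ::
    "'x measure \<Rightarrow> (real^'k::finite \<Rightarrow> 'x \<Rightarrow> real) \<Rightarrow> real^'k \<Rightarrow> real^'k^'k" where
  "fisher_info M p \<xi> = (\<chi> i j. \<integral>x. score p \<xi> i x * score p \<xi> j x \<partial>law M p \<xi>)"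

definition sym_pos_def :: "real^'k^'k::finite \<Rightarrow> bool" where
  "sym_pos_def A \<longleftrightarrow> transpose A = A \<and> (\<forall>v. v \<noteq> 0 \<longrightarrow> 0 < v \<bullet> (A *v v))"

text \<open>Openness of \<open>\<Xi>\<close> makes it a manifold, on which partial derivatives are meaningful.\<close>

definition regular_family ::
    "'x measure \<Rightarrow> (real^'k::finite) set \<Rightarrow> (real^'k \<Rightarrow> 'x \<Rightarrow> real) \<Rightarrow> bool" where
  "regular_family M \<Xi> p \<longleftrightarrow>
     open \<Xi> \<and> density_family M \<Xi> p \<and> partials_exist_AE M \<Xi> p \<and>
     diff_under_integral M \<Xi> p \<and> common_support M \<Xi> p \<and>
     (\<forall>\<xi>\<in>\<Xi>. (\<forall>i j. integrable (law M p \<xi>) (\<lambda>x. score p \<xi> i x * score p \<xi> j x)) \<and>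
            sym_pos_def (fisher_info M p \<xi>))"

section \<open>Rao distance\<close>

text \<open>Infinitely differentiable on the closed unit interval, one-sided at the endpoints:
  \<open>d n\<close> is the \<open>n\<close>-th derivative of \<open>\<alpha>\<close>.\<close>

definition smooth_path :: "(real \<Rightarrow> real^'k::finite) \<Rightarrow> bool" where
  "smooth_path \<alpha> \<longleftrightarrow>
     (\<exists>d :: nat \<Rightarrow> real \<Rightarrow> real^'k. d 0 = \<alpha> \<and>
        (\<forall>n. \<forall>t\<in>{0..1}. (d n has_vector_derivative d (Suc n) t) (at t within {0..1})))"

definition smooth_paths ::
    "(real^'k::finite) set \<Rightarrow> real^'k \<Rightarrow> real^'k \<Rightarrow> (real \<Rightarrow> real^'k) set" where
  "smooth_paths \<Xi> \<xi>\<^sub>1 \<xi>\<^sub>2 =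
     {\<alpha>. smooth_path \<alpha> \<and> \<alpha> ` {0..1} \<subseteq> \<Xi> \<and> \<alpha> 0 = \<xi>\<^sub>1 \<and> \<alpha> 1 = \<xi>\<^sub>2}"

text \<open>Lengths and distances are extended nonnegative reals; the distance of two parameters in
  different components of \<open>\<Xi>\<close> is \<open>\<infinity>\<close>.\<close>

definition path_length :: "(real^'k::finite \<Rightarrow> real^'k^'k) \<Rightarrow> (real \<Rightarrow> real^'k) \<Rightarrow> ennreal" where
  "path_length g \<alpha> =
     (\<integral>\<^sup>+t\<in>{0..1}. (let v = vector_derivative \<alpha> (at t within {0..1})
                   in ennreal (sqrt (v \<bullet> (g (\<alpha> t) *v v)))) \<partial>lborel)"

definition rao_dist ::
    "'x measure \<Rightarrow> (real^'k::finite) set \<Rightarrow> (real^'k \<Rightarrow> 'x \<Rightarrow> real) \<Rightarrow>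
     real^'k \<Rightarrow> real^'k \<Rightarrow> ennreal" where
  "rao_dist M \<Xi> p \<xi>\<^sub>1 \<xi>\<^sub>2 = (INF \<alpha>\<in>smooth_paths \<Xi> \<xi>\<^sub>1 \<xi>\<^sub>2. path_length (fisher_info M p) \<alpha>)"

section \<open>Rao differential privacy\<close>

text \<open>The mechanism releases a draw from the density \<open>p (par D)\<close> on the dataset \<open>D\<close>.\<close>

definition rao_private ::
    "'x measure \<Rightarrow> (real^'k::finite) set \<Rightarrow> (real^'k \<Rightarrow> 'x \<Rightarrow> real) \<Rightarrow>
     'd set \<Rightarrow> ('d multiset \<Rightarrow> real^'k) \<Rightarrow> real \<Rightarrow> bool" where
  "rao_private M \<Xi> p \<X> par \<theta> \<longleftrightarrow>
     (\<forall>D\<in>datasets \<X>. \<forall>D'\<in>datasets \<X>. adjacent D D' \<longrightarrow>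
        enn2ereal (rao_dist M \<Xi> p (par D) (par D')) \<le> ereal \<theta>)"

section \<open>Post-processing\<close>

text \<open>
  A random function is a Markov kernel \<open>\<phi>\<close>; a deterministic one is \<open>\<lambda>x. return N (f x)\<close>. The
  function \<open>q \<xi>\<close> is a density, with respect to \<open>N\<close>, of \<open>\<phi>\<close> applied to a draw from \<open>p \<xi>\<close>.
\<close>

definition postprocessed_family ::
    "'x measure \<Rightarrow> 'y measure \<Rightarrow> (real^'k) set \<Rightarrow> ('x \<Rightarrow> 'y measure) \<Rightarrow>
     (real^'k \<Rightarrow> 'x \<Rightarrow> real) \<Rightarrow> (real^'k \<Rightarrow> 'y \<Rightarrow> real) \<Rightarrow> bool" where
  "postprocessed_family M N \<Xi> \<phi> p q \<longleftrightarrow>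
     density_family N \<Xi> q \<and>
     (\<forall>\<xi>\<in>\<Xi>. density N (\<lambda>y. ennreal (q \<xi> y)) =
            Giry_Monad.bind (density M (\<lambda>x. ennreal (p \<xi> x))) \<phi>)"

end

theory Submission
  imports Defs
begin

text \<open>
  The Fisher information decreases under post-processing, as quadratic forms at every parameter;
  hence so do the lengths of paths and the Rao distance. Fix a direction \<open>v\<close>, let \<open>S\<close> and \<open>R\<close> be
  the scores of \<open>p\<close> and \<open>q\<close> at \<open>\<xi>\<close> in this direction, and \<open>P\<close>, \<open>Q\<close> the laws of the two outputs.
  Morally \<open>R\<close> is the conditional expectation of \<open>S\<close> given the processed output. Since
  differentiation under the integral is only available for \<open>p\<close>, restrict \<open>R\<close> to the set \<open>A k\<close> on
  which the difference quotients of \<open>q\<close> along a sequence are bounded by \<open>k * q\<close>: for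
  \<open>u = indicator (A k) * R\<close>, differentiating the expectation of \<open>u\<close> under \<open>q\<close> (by dominated
  convergence) and under \<open>p\<close> (as that of the bounded statistic \<open>\<integral>y. u y \<partial>\<phi> x\<close>) yields
  \<open>\<integral>u\<^sup>2 \<partial>Q = \<integral>(\<integral>u \<partial>\<phi> x) * S x \<partial>P \<le> (\<integral>u\<^sup>2 \<partial>Q + \<integral>S\<^sup>2 \<partial>P) / 2\<close>. The sets \<open>A k\<close> exhaust the
  space up to a null set of \<open>Q\<close>, which gives \<open>\<integral>R\<^sup>2 \<partial>Q \<le> \<integral>S\<^sup>2 \<partial>P\<close>.
\<close>

section \<open>Measurable versions of partial derivatives\<close>

text \<open>Preimages under \<open>f\<close> and \<open>g\<close> differ only inside a null set, all
  of whose subsets are measurable in the completion. This supplies the measurability of scores and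
  partial derivatives.\<close>

lemma borel_measurable_completion_cong_AE:
  fixes f g :: "'x \<Rightarrow> 'b::topological_space"
  assumes g: "g \<in> borel_measurable M" and eq: "AE x in M. f x = g x"
  shows "f \<in> borel_measurable (completion M)"
proof (rule borel_measurableI)
  fix S :: "'b set" assume S: "open S"
  obtain Z where Z: "Z \<in> null_sets M" "{x \<in> space M. f x \<noteq> g x} \<subseteq> Z"
    using eq unfolding eventually_ae_filter by auto
  have gS: "g -` S \<inter> space M - Z \<in> sets M"
    using g S Z(1) by (intro sets.Diff measurable_sets) auto
  have "f -` S \<inter> space M = (g -` S \<inter> space M - Z) \<union> (f -` S \<inter> space M \<inter> Z)"
    using Z(2) by auto
  then show "f -` S \<inter> space (completion M) \<in> sets (completion M)"
    using sets_completionI[OF _ _ Z(1) gS, of _ "f -` S \<inter> space M \<inter> Z"] by auto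
qed

text \<open>A sequence of steps, rather than a continuous limit, keeps suprema and limits countable
  and hence measurable. The scale \<open>h\<close> will be chosen so that every sampled parameter
  lies in \<open>\<Xi>\<close>; \<open>Suc n\<close> keeps the step nonzero.\<close>

definition diff_quot ::
    "real \<Rightarrow> (real^'k::finite \<Rightarrow> 'x \<Rightarrow> real) \<Rightarrow> real^'k \<Rightarrow> 'k \<Rightarrow> nat \<Rightarrow> 'x \<Rightarrow> real" where
  "diff_quot h p \<xi> i n x =
     (p (\<xi> + (h / real (Suc n)) *\<^sub>R axis i 1) x - p \<xi> x) / (h / real (Suc n))"

text \<open>
  The sequential limits below are Borel measurable versions of the partial derivative and of the
  score, which themselves are only measurable with respect to the completion.
\<close>

definition lim_partial ::
    "real \<Rightarrow> (real^'k::finite \<Rightarrow> 'x \<Rightarrow> real) \<Rightarrow> real^'k \<Rightarrow> 'k \<Rightarrow> 'x \<Rightarrow> real" where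
  "lim_partial h p \<xi> i x = lim (\<lambda>n. diff_quot h p \<xi> i n x)"

definition lim_score ::
    "real \<Rightarrow> (real^'k::finite \<Rightarrow> 'x \<Rightarrow> real) \<Rightarrow> real^'k \<Rightarrow> 'k \<Rightarrow> 'x \<Rightarrow> real" where
  "lim_score h p \<xi> i x = lim_partial h p \<xi> i x / p \<xi> x"

lemma has_real_derivative_imp_seq:
  fixes f :: "real \<Rightarrow> real"
  assumes f: "(f has_real_derivative D) (at 0)" and h: "0 < h"
  shows "(\<lambda>n. (f (h / real (Suc n)) - f 0) / (h / real (Suc n))) \<longlonglongrightarrow> D"
proof -
  have "((\<lambda>t. (f t - f 0) / t) \<longlongrightarrow> D) (at 0)"
    using f by (simp add: has_field_derivative_iff)
  moreover have "filterlim (\<lambda>n. h / real (Suc n)) (at 0) sequentially"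
    using h LIMSEQ_Suc[OF lim_const_over_n[of h]] by (intro filterlim_atI) (auto simp del: of_nat_Suc)
  ultimately show ?thesis
    by (rule filterlim_compose)
qed

lemma diff_quot_tendsto_partial_deriv:
  assumes "(\<lambda>t. p (\<xi> + t *\<^sub>R axis i 1) x) differentiable (at 0)" "0 < h"
  shows "(\<lambda>n. diff_quot h p \<xi> i n x) \<longlonglongrightarrow> partial_deriv i (\<lambda>\<eta>. p \<eta> x) \<xi>"
    and "lim_partial h p \<xi> i x = partial_deriv i (\<lambda>\<eta>. p \<eta> x) \<xi>"
proof -
  let ?f = "\<lambda>t. p (\<xi> + t *\<^sub>R axis i 1) x"
  have "(?f has_real_derivative partial_deriv i (\<lambda>\<eta>. p \<eta> x) \<xi>) (at 0)"
    using assms(1) unfolding partial_deriv_def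
    by (metis DERIV_imp_deriv real_differentiable_def)
  from has_real_derivative_imp_seq[OF this assms(2)]
  show "(\<lambda>n. diff_quot h p \<xi> i n x) \<longlonglongrightarrow> partial_deriv i (\<lambda>\<eta>. p \<eta> x) \<xi>"
    by (simp add: diff_quot_def)
  then show "lim_partial h p \<xi> i x = partial_deriv i (\<lambda>\<eta>. p \<eta> x) \<xi>"
    unfolding lim_partial_def by (rule limI)
qed

lemma score_eq_partial_deriv:
  assumes "(\<lambda>t. p (\<xi> + t *\<^sub>R axis i 1) x) differentiable (at 0)" "0 < p \<xi> x"
  shows "score p \<xi> i x = partial_deriv i (\<lambda>\<eta>. p \<eta> x) \<xi> / p \<xi> x"
proof -
  let ?f = "\<lambda>t. p (\<xi> + t *\<^sub>R axis i 1) x"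
  have "(?f has_real_derivative partial_deriv i (\<lambda>\<eta>. p \<eta> x) \<xi>) (at 0)"
    using assms(1) unfolding partial_deriv_def
    by (metis DERIV_imp_deriv real_differentiable_def)
  then have "((\<lambda>t. ln (?f t)) has_real_derivative partial_deriv i (\<lambda>\<eta>. p \<eta> x) \<xi> / p \<xi> x) (at 0)"
    using assms(2) by (auto intro!: derivative_eq_intros)
  then show ?thesis
    unfolding score_def by (subst partial_deriv_def) (rule DERIV_imp_deriv)
qed

section \<open>Scores and Fisher information at a fixed parameter\<close>

context
  fixes M :: "'x measure" and \<Xi> :: "(real^'k::finite) set"
    and p :: "real^'k \<Rightarrow> 'x \<Rightarrow> real" and \<xi> :: "real^'k" and h :: real
  assumes dens: "density_family M \<Xi> p" and ae: "partials_exist_AE M \<Xi> p" and h: "0 < h"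
    and seg: "\<And>i n. \<xi> + (h / real (Suc n)) *\<^sub>R axis i 1 \<in> \<Xi>" and \<xi>: "\<xi> \<in> \<Xi>"
begin

lemma density_measurable: "p \<xi> \<in> borel_measurable M"
  and density_nonneg: "x \<in> space M \<Longrightarrow> 0 \<le> p \<xi> x"
  using dens \<xi> by (auto simp: density_family_def)

lemma diff_quot_measurable: "diff_quot h p \<xi> i n \<in> borel_measurable M"
proof -
  have [measurable]: "p (\<xi> + (h / real (Suc n)) *\<^sub>R axis i 1) \<in> borel_measurable M"
    using dens seg by (auto simp: density_family_def)
  note density_measurable[measurable]
  show ?thesis unfolding diff_quot_def[abs_def] by measurable
qed

lemma lim_partial_measurable: "lim_partial h p \<xi> i \<in> borel_measurable M"
  unfolding lim_partial_def[abs_def] using diff_quot_measurable by measurable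

lemma lim_score_measurable: "lim_score h p \<xi> i \<in> borel_measurable M"
  unfolding lim_score_def[abs_def] using lim_partial_measurable density_measurable by measurable

lemma AE_diff_quot_tendsto: "AE x in M. \<forall>i. (\<lambda>n. diff_quot h p \<xi> i n x) \<longlonglongrightarrow> lim_partial h p \<xi> i x"
proof -
  have "AE x in M. \<forall>i. (\<lambda>t. p (\<xi> + t *\<^sub>R axis i 1) x) differentiable (at 0)"
    using ae \<xi> unfolding partials_exist_AE_def by (intro AE_all_countable[THEN iffD2]) auto
  then show ?thesis
    by eventually_elim (metis diff_quot_tendsto_partial_deriv h)
qed

lemma AE_lim_partial: "AE x in M. lim_partial h p \<xi> i x = partial_deriv i (\<lambda>\<eta>. p \<eta> x) \<xi>"
proof -
  have "AE x in M. (\<lambda>t. p (\<xi> + t *\<^sub>R axis i 1) x) differentiable (at 0)"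
    using ae \<xi> unfolding partials_exist_AE_def by auto
  then show ?thesis
    by eventually_elim (metis diff_quot_tendsto_partial_deriv(2) h)
qed

text \<open>Points where the density vanishes are null for the law, so the formula for the
  derivative of \<open>ln\<close> is only needed where \<open>p \<xi> x > 0\<close>.\<close>

lemma AE_score_eq_lim_score:
  "AE x in density M (\<lambda>x. ennreal (p \<xi> x)). \<forall>i. score p \<xi> i x = lim_score h p \<xi> i x"
proof -
  have "AE x in M. \<forall>i. (\<lambda>t. p (\<xi> + t *\<^sub>R axis i 1) x) differentiable (at 0)"
    using ae \<xi> unfolding partials_exist_AE_def by (intro AE_all_countable[THEN iffD2]) auto
  then have "AE x in M. 0 < ennreal (p \<xi> x) \<longrightarrow> (\<forall>i. score p \<xi> i x = lim_score h p \<xi> i x)"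
    by eventually_elim
      (auto simp: lim_score_def score_eq_partial_deriv diff_quot_tendsto_partial_deriv(2) h)
  then show ?thesis
    using density_measurable by (subst AE_density) auto
qed

text \<open>Passes from the completed law to the plain density measure: the integrands agree almost
  everywhere, and completion preserves the integrals of Borel measurable functions.\<close>

lemma integrable_law_score_iff:
  "integrable (law M p \<xi>) (\<lambda>x. score p \<xi> i x * score p \<xi> j x) \<longleftrightarrow>
   integrable (density M (\<lambda>x. ennreal (p \<xi> x))) (\<lambda>x. lim_score h p \<xi> i x * lim_score h p \<xi> j x)"
  and integral_law_score:
  "(\<integral>x. score p \<xi> i x * score p \<xi> j x \<partial>law M p \<xi>) =
   (\<integral>x. lim_score h p \<xi> i x * lim_score h p \<xi> j x \<partial>density M (\<lambda>x. ennreal (p \<xi> x)))"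
proof -
  let ?P = "density M (\<lambda>x. ennreal (p \<xi> x))"
  let ?s = "\<lambda>x. score p \<xi> i x * score p \<xi> j x"
  let ?l = "\<lambda>x. lim_score h p \<xi> i x * lim_score h p \<xi> j x"
  have l: "?l \<in> borel_measurable ?P"
    using lim_score_measurable by measurable
  have eq: "AE x in ?P. ?s x = ?l x"
    using AE_score_eq_lim_score by eventually_elim simp
  have s: "?s \<in> borel_measurable (completion ?P)"
    by (rule borel_measurable_completion_cong_AE[OF l eq])
  show "integrable (law M p \<xi>) ?s \<longleftrightarrow> integrable ?P ?l"
    unfolding law_def integrable_completion[OF l, symmetric]
    by (rule integrable_cong_AE[OF s measurable_completion[OF l] AE_completion[OF eq]])
  show "integral\<^sup>L (law M p \<xi>) ?s = integral\<^sup>L ?P ?l"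
    unfolding law_def integral_completion[OF l, symmetric]
    by (rule integral_cong_AE[OF s measurable_completion[OF l] AE_completion[OF eq]])
qed

text \<open>Expanding the square of the directional score gives a double sum; integrability of each
  product allows summation and integration to be exchanged.\<close>

lemma fisher_info_quadratic_form:
  assumes "\<And>i j. integrable (density M (\<lambda>x. ennreal (p \<xi> x)))
             (\<lambda>x. lim_score h p \<xi> i x * lim_score h p \<xi> j x)"
  shows "integrable (density M (\<lambda>x. ennreal (p \<xi> x))) (\<lambda>x. (\<Sum>i\<in>UNIV. v $ i * lim_score h p \<xi> i x)\<^sup>2)"
    and "v \<bullet> (fisher_info M p \<xi> *v v) =
       (\<integral>x. (\<Sum>i\<in>UNIV. v $ i * lim_score h p \<xi> i x)\<^sup>2 \<partial>density M (\<lambda>x. ennreal (p \<xi> x)))"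
proof -
  let ?P = "density M (\<lambda>x. ennreal (p \<xi> x))"
  let ?l = "\<lambda>i x. lim_score h p \<xi> i x"
  have sq: "(\<Sum>i\<in>UNIV. v $ i * ?l i x)\<^sup>2 = (\<Sum>i\<in>UNIV. \<Sum>j\<in>UNIV. (v $ i * v $ j) * (?l i x * ?l j x))" for x
    by (simp add: power2_eq_square sum_product mult_ac)
  show "integrable ?P (\<lambda>x. (\<Sum>i\<in>UNIV. v $ i * ?l i x)\<^sup>2)"
    unfolding sq using assms by (intro Bochner_Integration.integrable_sum integrable_mult_right)
  show "v \<bullet> (fisher_info M p \<xi> *v v) = (\<integral>x. (\<Sum>i\<in>UNIV. v $ i * ?l i x)\<^sup>2 \<partial>?P)"
    unfolding sq using assms
    by (subst Bochner_Integration.integral_sum, (intro Bochner_Integration.integrable_sum integrable_mult_right, assumption)+)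
      (simp add: Bochner_Integration.integral_sum fisher_info_def integral_law_score inner_vec_def
        matrix_vector_mult_def sum_distrib_left mult_ac)
qed

end

lemma prob_space_density_family:
  assumes "density_family M \<Xi> p" "\<xi> \<in> \<Xi>"
  shows "prob_space (density M (\<lambda>x. ennreal (p \<xi> x)))"
  using assms unfolding density_family_def
  by (intro prob_spaceI) (simp add: emeasure_density cong: nn_integral_cong)

lemma axis_segment_in_open:
  fixes \<xi> :: "real^'k::finite"
  assumes "open \<Xi>" "\<xi> \<in> \<Xi>"
  obtains h where "0 < h" "\<And>i n. \<xi> + (h / real (Suc n)) *\<^sub>R axis i 1 \<in> \<Xi>"
proof -
  obtain e where e: "0 < e" "ball \<xi> e \<subseteq> \<Xi>"
    using assms by (auto simp: open_contains_ball)
  \<comment> \<open>Half the radius keeps even the largest step, at \<open>n = 0\<close>, strictly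
    inside the open ball.\<close>
  have "\<xi> + (e / 2 / real (Suc n)) *\<^sub>R axis i 1 \<in> ball \<xi> e" for i n
  proof -
    have "e / 2 / real (Suc n) \<le> e / 2"
      using e by (intro divide_le_eq[THEN iffD2]) auto
    also have "\<dots> < e" using e by simp
    finally show ?thesis using e by (simp add: dist_norm)
  qed
  moreover have "0 < e / 2" using e by simp
  ultimately show thesis using e(2) that by blast
qed

section \<open>Monotonicity of lengths and distances\<close>

lemma path_length_mono:
  assumes "\<And>t v. t \<in> {0..1} \<Longrightarrow> v \<bullet> (g (\<alpha> t) *v v) \<le> v \<bullet> (g' (\<alpha> t) *v v)"
  shows "path_length g \<alpha> \<le> path_length g' \<alpha>"
  unfolding path_length_def Let_def
  by (intro nn_integral_mono) (auto simp: indicator_def intro!: ennreal_leI assms)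

text \<open>Both families have the same parameter set, hence the same admissible paths, so each path
  is its own competitor in the other infimum.\<close>

lemma rao_dist_mono:
  assumes "\<And>\<xi> v. \<xi> \<in> \<Xi> \<Longrightarrow> v \<bullet> (fisher_info N q \<xi> *v v) \<le> v \<bullet> (fisher_info M p \<xi> *v v)"
  shows "rao_dist N \<Xi> q \<xi>\<^sub>1 \<xi>\<^sub>2 \<le> rao_dist M \<Xi> p \<xi>\<^sub>1 \<xi>\<^sub>2"
  unfolding rao_dist_def
proof (rule INF_mono)
  fix \<alpha> assume "\<alpha> \<in> smooth_paths \<Xi> \<xi>\<^sub>1 \<xi>\<^sub>2"
  moreover from this have "path_length (fisher_info N q) \<alpha> \<le> path_length (fisher_info M p) \<alpha>"
    by (intro path_length_mono assms) (auto simp: smooth_paths_def)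
  ultimately show "\<exists>\<beta>\<in>smooth_paths \<Xi> \<xi>\<^sub>1 \<xi>\<^sub>2. path_length (fisher_info N q) \<beta> \<le> path_length (fisher_info M p) \<alpha>"
    by blast
qed

section \<open>Averaging over the kernel and differentiating expectations\<close>

text \<open>The tower property: the law of the processed output is a Giry bind, and a bounded
  statistic may be integrated over it in two stages.\<close>

lemma integral_postprocessed:
  fixes u :: "'y \<Rightarrow> real" and p :: "real^'k::finite \<Rightarrow> 'x \<Rightarrow> real"
  assumes dp: "density_family M \<Xi> p" and \<phi>: "\<phi> \<in> M \<rightarrow>\<^sub>M prob_algebra N"
    and post: "postprocessed_family M N \<Xi> \<phi> p q" and \<eta>: "\<eta> \<in> \<Xi>"
    and u: "u \<in> borel_measurable N" and B: "\<And>y. \<bar>u y\<bar> \<le> B"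
  shows "(\<integral>y. u y \<partial>density N (\<lambda>y. ennreal (q \<eta> y))) =
         (\<integral>x. (\<integral>y. u y \<partial>\<phi> x) \<partial>density M (\<lambda>x. ennreal (p \<eta> x)))"
proof -
  let ?P = "density M (\<lambda>x. ennreal (p \<eta> x))"
  interpret P: prob_space ?P by (rule prob_space_density_family[OF dp \<eta>])
  have \<phi>P: "\<phi> \<in> ?P \<rightarrow>\<^sub>M subprob_algebra N"
    using measurable_prob_algebraD[OF \<phi>] by simp
  have "AE x in ?P. emeasure (\<phi> x) (space (\<phi> x)) \<le> ennreal 1"
    using subprob_space.emeasure_space_le_1[OF subprob_space_kernel[OF \<phi>P]] by (intro AE_I2) simp
  then have "(\<integral>y. u y \<partial>Giry_Monad.bind ?P \<phi>) = (\<integral>x. (\<integral>y. u y \<partial>\<phi> x) \<partial>?P)"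
    using B P.finite_measure_axioms
    by (intro integral_bind[where K=N and B=B and B'=1] u \<phi>P) auto
  then show ?thesis
    using post \<eta> by (simp add: postprocessed_family_def)
qed

text \<open>Together with the measurability below, this makes the kernel average of a bounded
  statistic admissible as \<open>T\<close> in \<open>diff_under_integral\<close>.\<close>

lemma abs_kernel_integral_le:
  fixes u :: "'y \<Rightarrow> real"
  assumes \<phi>: "\<phi> \<in> M \<rightarrow>\<^sub>M prob_algebra N" and x: "x \<in> space M"
    and u: "u \<in> borel_measurable N" and B: "\<And>y. \<bar>u y\<bar> \<le> B"
  shows "integrable (\<phi> x) u" "\<bar>\<integral>y. u y \<partial>\<phi> x\<bar> \<le> B"
proof -
  have "\<phi> x \<in> space (prob_algebra N)"
    using \<phi> x by (rule measurable_space)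
  then have K: "prob_space (\<phi> x)" and sets: "sets (\<phi> x) = sets N"
    by (auto simp: space_prob_algebra)
  interpret prob_space "\<phi> x" by (rule K)
  have u': "u \<in> borel_measurable (\<phi> x)"
    using u measurable_cong_sets[OF sets refl] by blast
  show int: "integrable (\<phi> x) u"
    using B u' by (intro integrable_const_bound[where B=B]) auto
  have "\<bar>\<integral>y. u y \<partial>\<phi> x\<bar> \<le> (\<integral>y. \<bar>u y\<bar> \<partial>\<phi> x)"
    by (rule integral_abs_bound)
  also have "\<dots> \<le> B"
    using B int by (intro integral_le_const) auto
  finally show "\<bar>\<integral>y. u y \<partial>\<phi> x\<bar> \<le> B" .
qed

lemma kernel_integral_measurable:
  fixes u :: "'y \<Rightarrow> real"
  assumes "\<phi> \<in> M \<rightarrow>\<^sub>M prob_algebra N" "u \<in> borel_measurable N"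
  shows "(\<lambda>x. \<integral>y. u y \<partial>\<phi> x) \<in> borel_measurable M"
  using measurable_compose[OF measurable_prob_algebraD[OF assms(1)]
    integral_measurable_subprob_algebra[OF assms(2)]] .

text \<open>
  On the support of \<open>u\<close> the difference quotients of \<open>q\<close> are dominated by a multiple of \<open>q \<xi>\<close>, so the
  derivative of the expectation of \<open>u\<close> can be computed in two ways.
\<close>

lemma integral_score_postprocessed:
  fixes u :: "'y \<Rightarrow> real" and p :: "real^'k::finite \<Rightarrow> 'x \<Rightarrow> real"
  assumes reg: "regular_family M \<Xi> p" and \<phi>: "\<phi> \<in> M \<rightarrow>\<^sub>M prob_algebra N"
    and post: "postprocessed_family M N \<Xi> \<phi> p q" and aeq: "partials_exist_AE N \<Xi> q"
    and \<xi>: "\<xi> \<in> \<Xi>" and h: "0 < h"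
    and seg: "\<And>i n. \<xi> + (h / real (Suc n)) *\<^sub>R axis i 1 \<in> \<Xi>"
    and u: "u \<in> borel_measurable N" and B: "\<And>y. \<bar>u y\<bar> \<le> B"
    and dom: "\<And>y n. u y \<noteq> 0 \<Longrightarrow> \<bar>diff_quot h q \<xi> i n y\<bar> \<le> C * q \<xi> y"
    and pos: "\<And>y. u y \<noteq> 0 \<Longrightarrow> 0 < q \<xi> y"
  shows "(\<integral>y. u y * lim_score h q \<xi> i y \<partial>density N (\<lambda>y. ennreal (q \<xi> y))) =
         (\<integral>x. (\<integral>y. u y \<partial>\<phi> x) * lim_score h p \<xi> i x \<partial>density M (\<lambda>x. ennreal (p \<xi> x)))"
proof -
  have dp: "density_family M \<Xi> p" and aep: "partials_exist_AE M \<Xi> p"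
    and diff: "diff_under_integral M \<Xi> p" and supp: "common_support M \<Xi> p"
    using reg by (auto simp: regular_family_def)
  have dq: "density_family N \<Xi> q"
    using post by (simp add: postprocessed_family_def)
  let ?T = "\<lambda>x. \<integral>y. u y \<partial>\<phi> x"
  let ?e = "\<lambda>n. \<xi> + (h / real (Suc n)) *\<^sub>R axis i 1"
  have T: "?T \<in> borel_measurable M" by (rule kernel_integral_measurable[OF \<phi> u])
  have T_le: "\<bar>?T x\<bar> \<le> B" if "x \<in> space M" for x
    by (rule abs_kernel_integral_le[OF \<phi> that u B])
  have B0: "0 \<le> B" using B[of undefined] by linarith
  \<comment> \<open>Valid at every sampled parameter as well as at \<open>\<xi>\<close>, so the two
    sides also have equal difference quotients.\<close>
  have eq: "(\<integral>y. u y * q \<eta> y \<partial>N) = (\<integral>x. ?T x * p \<eta> x \<partial>M)" if \<eta>: "\<eta> \<in> \<Xi>" for \<eta>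
    using integral_postprocessed[OF dp \<phi> post \<eta> u B] u T dp dq \<eta>
    by (simp add: integral_density density_family_def mult_ac)
  have q_int: "integrable N (q \<eta>)" if \<eta>: "\<eta> \<in> \<Xi>" for \<eta>
    using dq \<eta> by (intro integrableI_nn_integral_finite[where x=1]) (auto simp: density_family_def)
  have uq_int: "integrable N (\<lambda>y. u y * q \<eta> y)" if \<eta>: "\<eta> \<in> \<Xi>" for \<eta>
  proof (rule Bochner_Integration.integrable_bound)
    show "integrable N (\<lambda>y. B * q \<eta> y)" using q_int[OF \<eta>] by simp
    show "(\<lambda>y. u y * q \<eta> y) \<in> borel_measurable N" using u q_int[OF \<eta>] by measurable
    show "AE y in N. norm (u y * q \<eta> y) \<le> norm (B * q \<eta> y)"
      using B B0 by (intro AE_I2) (auto simp: abs_mult intro!: mult_right_mono)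
  qed
  have quot: "(\<integral>y. u y * diff_quot h q \<xi> i n y \<partial>N) =
      ((\<integral>x. ?T x * p (?e n) x \<partial>M) - (\<integral>x. ?T x * p \<xi> x \<partial>M)) / (h / real (Suc n))" for n
  proof -
    have "(\<integral>y. u y * diff_quot h q \<xi> i n y \<partial>N) = (\<integral>y. (u y * q (?e n) y - u y * q \<xi> y) / (h / real (Suc n)) \<partial>N)"
      by (simp only: diff_quot_def right_diff_distrib times_divide_eq_right)
    also have "\<dots> = ((\<integral>y. u y * q (?e n) y \<partial>N) - (\<integral>y. u y * q \<xi> y \<partial>N)) / (h / real (Suc n))"
      by (simp only: integral_divide_zero Bochner_Integration.integral_diff[OF uq_int[OF seg] uq_int[OF \<xi>]])
    finally show ?thesis by (simp only: eq[OF seg] eq[OF \<xi>])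
  qed
  have "bounded (?T ` space M)"
    using T_le by (auto simp: bounded_iff intro!: exI[of _ B])
  then have "((\<lambda>t. \<integral>x. ?T x * p (\<xi> + t *\<^sub>R axis i 1) x \<partial>M) has_real_derivative
            (\<integral>x. ?T x * partial_deriv i (\<lambda>\<eta>. p \<eta> x) \<xi> \<partial>completion M)) (at 0)"
    using diff \<xi> T unfolding diff_under_integral_def by blast
  from has_real_derivative_imp_seq[OF this h]
  have lim1: "(\<lambda>n. \<integral>y. u y * diff_quot h q \<xi> i n y \<partial>N) \<longlonglongrightarrow>
      (\<integral>x. ?T x * partial_deriv i (\<lambda>\<eta>. p \<eta> x) \<xi> \<partial>completion M)"
    unfolding quot by simp
  \<comment> \<open>The dominating function uses the absolute value of \<open>C\<close> because no
    sign of \<open>C\<close> is assumed.\<close>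
  have lim2: "(\<lambda>n. \<integral>y. u y * diff_quot h q \<xi> i n y \<partial>N) \<longlonglongrightarrow> (\<integral>y. u y * lim_partial h q \<xi> i y \<partial>N)"
  proof (rule integral_dominated_convergence[where w="\<lambda>y. B * \<bar>C\<bar> * q \<xi> y"])
    show "(\<lambda>y. u y * lim_partial h q \<xi> i y) \<in> borel_measurable N"
      using u lim_partial_measurable[OF dq aeq h seg \<xi>] by measurable
    show "(\<lambda>y. u y * diff_quot h q \<xi> i n y) \<in> borel_measurable N" for n
      using u diff_quot_measurable[OF dq aeq h seg \<xi>] by measurable
    show "integrable N (\<lambda>y. B * \<bar>C\<bar> * q \<xi> y)"
      using q_int[OF \<xi>] by simp
    show "AE y in N. (\<lambda>n. u y * diff_quot h q \<xi> i n y) \<longlonglongrightarrow> u y * lim_partial h q \<xi> i y"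
      using AE_diff_quot_tendsto[OF dq aeq h seg \<xi>] by eventually_elim (auto intro: tendsto_mult_left)
    show "AE y in N. norm (u y * diff_quot h q \<xi> i n y) \<le> B * \<bar>C\<bar> * q \<xi> y" for n
    proof (rule AE_I2)
      fix y assume y: "y \<in> space N"
      show "norm (u y * diff_quot h q \<xi> i n y) \<le> B * \<bar>C\<bar> * q \<xi> y"
      proof (cases "u y = 0")
        case True
        then show ?thesis using B0 density_nonneg[OF dq aeq h seg \<xi> y] by simp
      next
        case False
        have "\<bar>diff_quot h q \<xi> i n y\<bar> \<le> \<bar>C\<bar> * q \<xi> y"
          using dom[OF False, of n] mult_right_mono[of C "\<bar>C\<bar>" "q \<xi> y"] pos[OF False] by linarith
        then have "\<bar>u y\<bar> * \<bar>diff_quot h q \<xi> i n y\<bar> \<le> B * (\<bar>C\<bar> * q \<xi> y)"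
          using B B0 by (intro mult_mono) auto
        then show ?thesis by (simp add: abs_mult mult_ac)
      qed
    qed
  qed
  \<comment> \<open>Division by zero makes \<open>lim_score\<close> equal to 0 where
    \<open>p \<xi> x = 0\<close>, so the partial derivative must vanish there too. The common
    support forces this: all sampled densities are 0 at such \<open>x\<close>.\<close>
  have zero: "partial_deriv i (\<lambda>\<eta>. p \<eta> x) \<xi> = 0"
    if "lim_partial h p \<xi> i x = partial_deriv i (\<lambda>\<eta>. p \<eta> x) \<xi>" "x \<in> space M" "p \<xi> x = 0" for x
  proof -
    have "p (?e n) x = 0" for n
      using supp seg[of n i] \<xi> that(2,3) unfolding common_support_def by blast
    then have "diff_quot h p \<xi> i n x = 0" for n
      using that(3) by (simp add: diff_quot_def)
    then have "lim_partial h p \<xi> i x = 0"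
      by (simp add: lim_partial_def)
    with that(1) show ?thesis by simp
  qed
  have aeP: "AE x in M. partial_deriv i (\<lambda>\<eta>. p \<eta> x) \<xi> = p \<xi> x * lim_score h p \<xi> i x"
    using AE_lim_partial[OF dp aep h seg \<xi>, of i] AE_space
    by eventually_elim (use zero in \<open>auto simp: lim_score_def\<close>)
  note [measurable] = T u density_measurable[OF dp aep h seg \<xi>] lim_score_measurable[OF dp aep h seg \<xi>]
    density_measurable[OF dq aeq h seg \<xi>] lim_score_measurable[OF dq aeq h seg \<xi>]
  have m: "(\<lambda>x. p \<xi> x *\<^sub>R (?T x * lim_score h p \<xi> i x)) \<in> borel_measurable M"
    by measurable
  have ae2: "AE x in M. ?T x * partial_deriv i (\<lambda>\<eta>. p \<eta> x) \<xi> = p \<xi> x *\<^sub>R (?T x * lim_score h p \<xi> i x)"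
    using aeP by eventually_elim simp
  have "(\<integral>y. u y * lim_score h q \<xi> i y \<partial>density N (\<lambda>y. ennreal (q \<xi> y))) =
        (\<integral>y. q \<xi> y *\<^sub>R (u y * lim_score h q \<xi> i y) \<partial>N)"
    using density_nonneg[OF dq aeq h seg \<xi>] by (intro integral_density) auto
  \<comment> \<open>Where \<open>u\<close> is nonzero, \<open>q \<xi>\<close> is positive and
    cancels the denominator of the score; elsewhere both integrands are 0.\<close>
  also have "\<dots> = (\<integral>y. u y * lim_partial h q \<xi> i y \<partial>N)"
    using pos by (intro Bochner_Integration.integral_cong refl) (force simp: lim_score_def)
  also have "\<dots> = (\<integral>x. ?T x * partial_deriv i (\<lambda>\<eta>. p \<eta> x) \<xi> \<partial>completion M)"
    by (rule LIMSEQ_unique[OF lim2 lim1])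
  also have "\<dots> = (\<integral>x. p \<xi> x *\<^sub>R (?T x * lim_score h p \<xi> i x) \<partial>completion M)"
    by (intro integral_cong_AE borel_measurable_completion_cong_AE[OF m ae2]
        measurable_completion[OF m] AE_completion[OF ae2])
  also have "\<dots> = (\<integral>x. p \<xi> x *\<^sub>R (?T x * lim_score h p \<xi> i x) \<partial>M)"
    by (rule integral_completion[OF m])
  also have "\<dots> = (\<integral>x. ?T x * lim_score h p \<xi> i x \<partial>density M (\<lambda>x. ennreal (p \<xi> x)))"
    using density_nonneg[OF dp aep h seg \<xi>] by (intro integral_density[symmetric]) auto
  finally show ?thesis .
qed

section \<open>The information inequality\<close>

text \<open>The left integral takes values in \<open>[0, \<infinity>]\<close> because finiteness of
  the second moment of the score of \<open>q\<close> is part of what is proved.\<close>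

lemma nn_integral_square_score_postprocessed:
  fixes p :: "real^'k::finite \<Rightarrow> 'x \<Rightarrow> real" and q :: "real^'k \<Rightarrow> 'y \<Rightarrow> real" and v :: "real^'k"
  assumes reg: "regular_family M \<Xi> p" and \<phi>: "\<phi> \<in> M \<rightarrow>\<^sub>M prob_algebra N"
    and post: "postprocessed_family M N \<Xi> \<phi> p q" and aeq: "partials_exist_AE N \<Xi> q"
    and \<xi>: "\<xi> \<in> \<Xi>" and h: "0 < h"
    and seg: "\<And>i n. \<xi> + (h / real (Suc n)) *\<^sub>R axis i 1 \<in> \<Xi>"
  shows "(\<integral>\<^sup>+y. ennreal ((\<Sum>i\<in>UNIV. v $ i * lim_score h q \<xi> i y)\<^sup>2) \<partial>density N (\<lambda>y. ennreal (q \<xi> y)))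
         \<le> ennreal (\<integral>x. (\<Sum>i\<in>UNIV. v $ i * lim_score h p \<xi> i x)\<^sup>2 \<partial>density M (\<lambda>x. ennreal (p \<xi> x)))"
proof -
  have dp: "density_family M \<Xi> p" and aep: "partials_exist_AE M \<Xi> p"
    using reg by (auto simp: regular_family_def)
  have dq: "density_family N \<Xi> q"
    using post by (simp add: postprocessed_family_def)
  define P where "P = density M (\<lambda>x. ennreal (p \<xi> x))"
  define Q where "Q = density N (\<lambda>y. ennreal (q \<xi> y))"
  define r where "r = lim_score h q \<xi>"
  define s where "s = lim_score h p \<xi>"
  define R where "R y = (\<Sum>i\<in>UNIV. v $ i * r i y)" for y
  define S where "S x = (\<Sum>i\<in>UNIV. v $ i * s i x)" for x
  interpret P: prob_space P unfolding P_def by (rule prob_space_density_family[OF dp \<xi>])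
  interpret Q: prob_space Q unfolding Q_def by (rule prob_space_density_family[OF dq \<xi>])
  have PM [measurable_cong]: "sets P = sets M" and QN [measurable_cong]: "sets Q = sets N"
    by (simp_all add: P_def Q_def)
  have [measurable]: "s i \<in> borel_measurable M" for i
    unfolding s_def by (rule lim_score_measurable[OF dp aep h seg \<xi>])
  have [measurable]: "r i \<in> borel_measurable N" for i
    unfolding r_def by (rule lim_score_measurable[OF dq aeq h seg \<xi>])
  have [measurable]: "R \<in> borel_measurable N" "S \<in> borel_measurable M"
    unfolding R_def[abs_def] S_def[abs_def] by measurable
  note [measurable] = density_measurable[OF dq aeq h seg \<xi>] diff_quot_measurable[OF dq aeq h seg \<xi>]
    lim_partial_measurable[OF dq aeq h seg \<xi>]
  have ss: "integrable P (\<lambda>x. s i x * s j x)" for i j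
    unfolding P_def s_def integrable_law_score_iff[OF dp aep h seg \<xi>, symmetric]
    using reg \<xi> by (simp add: regular_family_def)
  have s_int: "integrable P (s i)" for i
  proof (rule P.square_integrable_imp_integrable)
    show "integrable P (\<lambda>x. (s i x)\<^sup>2)" using ss[of i i] by (simp only: power2_eq_square)
  qed measurable
  have S_int: "integrable P (\<lambda>x. (S x)\<^sup>2)"
    unfolding P_def S_def s_def
    by (rule fisher_info_quadratic_form(1)[OF dp aep h seg \<xi>]) (use ss in \<open>simp add: P_def s_def\<close>)

  \<comment> \<open>The bound on \<open>lim_partial\<close> is a separate condition: where the
    quotients diverge, \<open>lim\<close> has an unspecified value that their bound does not
    control.\<close>
  define A where "A k = {y \<in> space N. 0 < q \<xi> y \<and>
      (\<forall>i n. \<bar>diff_quot h q \<xi> i n y\<bar> \<le> real k * q \<xi> y) \<and>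
      (\<forall>i. \<bar>lim_partial h q \<xi> i y\<bar> \<le> real k * q \<xi> y)}" for k
  define u where "u k y = indicator (A k) y * R y" for k y
  have A [measurable]: "A k \<in> sets N" for k
    unfolding A_def by measurable
  have u [measurable]: "u k \<in> borel_measurable N" for k
    unfolding u_def[abs_def] by measurable
  have r_le: "\<bar>r i y\<bar> \<le> real k" if "y \<in> A k" for i y k
    using that by (auto simp: A_def r_def lim_score_def abs_divide pos_divide_le_eq)
  have u_bound: "\<bar>u k y\<bar> \<le> (\<Sum>i\<in>UNIV. \<bar>v $ i\<bar> * real k)" for k y
  proof (cases "y \<in> A k")
    case True
    have "\<bar>R y\<bar> \<le> (\<Sum>i\<in>UNIV. \<bar>v $ i * r i y\<bar>)"
      unfolding R_def by (rule sum_abs)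
    also have "\<dots> \<le> (\<Sum>i\<in>UNIV. \<bar>v $ i\<bar> * real k)"
      using r_le[OF True] by (intro sum_mono) (auto simp: abs_mult intro!: mult_left_mono)
    finally show ?thesis using True by (simp add: u_def)
  qed (simp add: u_def sum_nonneg)

  have u_le: "(\<integral>y. (u k y)\<^sup>2 \<partial>Q) \<le> (\<integral>x. (S x)\<^sup>2 \<partial>P)" for k
  proof -
    define B where "B = (\<Sum>i\<in>UNIV. \<bar>v $ i\<bar> * real k)"
    define T where "T x = (\<integral>y. u k y \<partial>\<phi> x)" for x
    define T2 where "T2 x = (\<integral>y. (u k y)\<^sup>2 \<partial>\<phi> x)" for x
    have B: "\<bar>u k y\<bar> \<le> B" for y unfolding B_def by (rule u_bound)
    have u2: "(\<lambda>y. (u k y)\<^sup>2) \<in> borel_measurable N" by measurable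
    have B2: "\<bar>(u k y)\<^sup>2\<bar> \<le> B\<^sup>2" for y
      using power_mono[OF B[of y] abs_ge_zero, of 2] by simp
    have [measurable]: "T \<in> borel_measurable M" "T2 \<in> borel_measurable M"
      unfolding T_def[abs_def] T2_def[abs_def]
      by (rule kernel_integral_measurable[OF \<phi> u], rule kernel_integral_measurable[OF \<phi> u2])
    have T_le: "\<bar>T x\<bar> \<le> B" and T2_le: "\<bar>T2 x\<bar> \<le> B\<^sup>2" if "x \<in> space M" for x
      unfolding T_def T2_def
      by (rule abs_kernel_integral_le(2)[OF \<phi> that u B], rule abs_kernel_integral_le(2)[OF \<phi> that u2 B2])
    have space: "space P = space M" by (simp add: P_def)
    have T2_int: "integrable P T2"
      using T2_le by (intro P.integrable_const_bound[where B="B\<^sup>2"]) (auto simp: space)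
    have Ts_int: "integrable P (\<lambda>x. T x * s i x)" for i
    proof (rule Bochner_Integration.integrable_bound)
      show "integrable P (\<lambda>x. B * s i x)" using s_int by simp
      have "\<bar>T x\<bar> * \<bar>s i x\<bar> \<le> \<bar>B\<bar> * \<bar>s i x\<bar>" if "x \<in> space M" for x
        using T_le[OF that] by (intro mult_right_mono) auto
      then show "AE x in P. norm (T x * s i x) \<le> norm (B * s i x)"
        by (intro AE_I2) (auto simp: space abs_mult)
    qed measurable
    have ur_int: "integrable Q (\<lambda>y. u k y * r i y)" for i
    proof (rule Q.integrable_const_bound[where B="B * real k"])
      have "\<bar>u k y\<bar> * \<bar>r i y\<bar> \<le> B * real k" for y
      proof (cases "y \<in> A k")
        case True
        then show ?thesis using B[of y] r_le[OF True] by (intro mult_mono) auto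
      next
        case False
        have "0 \<le> B" using B[of y] by linarith
        with False show ?thesis by (simp add: u_def)
      qed
      then show "AE y in Q. norm (u k y * r i y) \<le> B * real k"
        by (intro AE_I2) (simp add: abs_mult)
    qed measurable
    \<comment> \<open>Differentiation under the integral is given along coordinate axes only; the
      direction \<open>v\<close> is recovered by linearity.\<close>
    have exch: "(\<integral>y. u k y * r i y \<partial>Q) = (\<integral>x. T x * s i x \<partial>P)" for i
      unfolding P_def Q_def r_def s_def T_def
    proof (rule integral_score_postprocessed[OF reg \<phi> post aeq \<xi> h seg u B, where C="real k"])
      fix y n assume "u k y \<noteq> 0"
      then have "y \<in> A k" by (auto simp: u_def indicator_def split: if_splits)
      then show "\<bar>diff_quot h q \<xi> i n y\<bar> \<le> real k * q \<xi> y" "0 < q \<xi> y"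
        by (auto simp: A_def)
    qed
    \<comment> \<open>An indicator is idempotent, so the square of \<open>u k\<close> equals
      \<open>u k * R\<close>, which is linear in the coordinate scores.\<close>
    have uR: "(u k y)\<^sup>2 = (\<Sum>i\<in>UNIV. v $ i * (u k y * r i y))" for y
    proof -
      have "(u k y)\<^sup>2 = u k y * R y"
        by (simp add: u_def power2_eq_square indicator_def)
      then show ?thesis by (simp add: R_def sum_distrib_left mult_ac)
    qed
    have TS: "T x * S x = (\<Sum>i\<in>UNIV. v $ i * (T x * s i x))" for x
      by (simp add: S_def sum_distrib_left mult_ac)
    have TS_int: "integrable P (\<lambda>x. T x * S x)"
      unfolding TS using Ts_int by (intro Bochner_Integration.integrable_sum integrable_mult_right)
    have "(\<integral>y. (u k y)\<^sup>2 \<partial>Q) = (\<Sum>i\<in>UNIV. v $ i * (\<integral>y. u k y * r i y \<partial>Q))"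
      unfolding uR using ur_int by (simp add: Bochner_Integration.integral_sum)
    also have "\<dots> = (\<integral>x. T x * S x \<partial>P)"
      unfolding TS exch using Ts_int by (simp add: Bochner_Integration.integral_sum)
    also have "\<dots> \<le> (\<integral>x. (T2 x + (S x)\<^sup>2) / 2 \<partial>P)"
    proof (rule integral_mono[OF TS_int])
      show "integrable P (\<lambda>x. (T2 x + (S x)\<^sup>2) / 2)" using T2_int S_int by simp
      fix x assume "x \<in> space P"
      then have x: "x \<in> space M" by (simp add: space)
      interpret K: prob_space "\<phi> x"
        using measurable_space[OF \<phi> x] by (simp add: space_prob_algebra)
      have i1: "integrable (\<phi> x) (u k)" and i2: "integrable (\<phi> x) (\<lambda>y. (u k y)\<^sup>2)"
        by (rule abs_kernel_integral_le(1)[OF \<phi> x u B], rule abs_kernel_integral_le(1)[OF \<phi> x u2 B2])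
      \<comment> \<open>Under the probability measure \<open>\<phi> x\<close> the number
        \<open>S x\<close> is constant; expanding this square replaces a Jensen and a Cauchy-Schwarz
        step at once.\<close>
      have "0 \<le> (\<integral>y. (u k y - S x)\<^sup>2 \<partial>\<phi> x)" by simp
      also have "\<dots> = (\<integral>y. (u k y)\<^sup>2 + (S x)\<^sup>2 - 2 * S x * u k y \<partial>\<phi> x)"
        by (simp add: power2_diff mult_ac)
      also have "\<dots> = T2 x + (S x)\<^sup>2 - 2 * S x * T x"
        using i1 i2 by (simp add: T_def T2_def K.prob_space)
      finally show "T x * S x \<le> (T2 x + (S x)\<^sup>2) / 2" by (simp add: mult_ac)
    qed
    also have "\<dots> = ((\<integral>x. T2 x \<partial>P) + (\<integral>x. (S x)\<^sup>2 \<partial>P)) / 2"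
      using T2_int S_int by simp
    \<comment> \<open>The left side of the chain reappears with factor one half. As a real number it
      can be subtracted, leaving the claim.\<close>
    also have "(\<integral>x. T2 x \<partial>P) = (\<integral>y. (u k y)\<^sup>2 \<partial>Q)"
      unfolding T2_def[abs_def] P_def Q_def
      by (rule integral_postprocessed[OF dp \<phi> post \<xi> u2 B2, symmetric])
    finally show ?thesis by simp
  qed

  have AE_A: "AE y in Q. \<exists>k. y \<in> A k"
  proof -
    have "AE y in N. 0 < ennreal (q \<xi> y) \<longrightarrow> (\<exists>k. y \<in> A k)"
      using AE_diff_quot_tendsto[OF dq aeq h seg \<xi>] AE_space
    proof eventually_elim
      fix y assume lim: "\<forall>i. (\<lambda>n. diff_quot h q \<xi> i n y) \<longlonglongrightarrow> lim_partial h q \<xi> i y" and y: "y \<in> space N"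
      show "0 < ennreal (q \<xi> y) \<longrightarrow> (\<exists>k. y \<in> A k)"
      proof
        assume "0 < ennreal (q \<xi> y)"
        then have q: "0 < q \<xi> y" by simp
        have "\<forall>i. \<exists>K. \<forall>n. \<bar>diff_quot h q \<xi> i n y\<bar> \<le> K"
        proof
          fix i
          have "Bseq (\<lambda>n. diff_quot h q \<xi> i n y)"
            using lim by (blast intro: convergent_imp_Bseq convergentI)
          then show "\<exists>K. \<forall>n. \<bar>diff_quot h q \<xi> i n y\<bar> \<le> K"
            by (auto simp: Bseq_def)
        qed
        then obtain K where K: "\<bar>diff_quot h q \<xi> i n y\<bar> \<le> K i" for i n by metis
        \<comment> \<open>Summing the nonnegative bounds over the finitely many coordinates gives
          one constant for all of them, so a single \<open>k\<close> above
          \<open>L / q \<xi> y\<close> works.\<close>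
        define L where "L = (\<Sum>i\<in>UNIV. K i + \<bar>lim_partial h q \<xi> i y\<bar>)"
        have K0: "0 \<le> K i" for i using K[of i 0] by linarith
        have KL: "K i + \<bar>lim_partial h q \<xi> i y\<bar> \<le> L" for i
          unfolding L_def by (rule member_le_sum) (auto simp: K0)
        have L: "K i \<le> L" "\<bar>lim_partial h q \<xi> i y\<bar> \<le> L" for i
          using KL[of i] K0[of i] by linarith+
        obtain k where "L / q \<xi> y \<le> real k" using real_arch_simple by blast
        then have "L \<le> real k * q \<xi> y" using q by (simp add: pos_divide_le_eq)
        then have "K i \<le> real k * q \<xi> y" "\<bar>lim_partial h q \<xi> i y\<bar> \<le> real k * q \<xi> y" for i
          using L[of i] by linarith+
        then have "y \<in> A k"
          using y q order_trans[OF K] unfolding A_def by blast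
        then show "\<exists>k. y \<in> A k" ..
      qed
    qed
    then show ?thesis unfolding Q_def by (subst AE_density) auto
  qed
  have "(\<integral>\<^sup>+y. ennreal ((R y)\<^sup>2) \<partial>Q) \<le> (\<integral>\<^sup>+y. (SUP k. ennreal ((u k y)\<^sup>2)) \<partial>Q)"
  proof (rule nn_integral_mono_AE)
    show "AE y in Q. ennreal ((R y)\<^sup>2) \<le> (SUP k. ennreal ((u k y)\<^sup>2))"
      using AE_A
    proof eventually_elim
      fix y assume "\<exists>k. y \<in> A k"
      then obtain k where "y \<in> A k" ..
      then have "u k y = R y" by (simp add: u_def)
      then show "ennreal ((R y)\<^sup>2) \<le> (SUP k. ennreal ((u k y)\<^sup>2))"
        by (intro SUP_upper2[of k]) auto
    qed
  qed
  also have "\<dots> = (SUP k. \<integral>\<^sup>+y. ennreal ((u k y)\<^sup>2) \<partial>Q)"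
  proof (rule nn_integral_monotone_convergence_SUP)
    \<comment> \<open>Positivity of \<open>q \<xi>\<close> on \<open>A k\<close> loosens the bounds
      as \<open>k\<close> grows, so the truncated squares increase.\<close>
    have "A k \<subseteq> A l" if "k \<le> l" for k l
    proof
      fix y assume y: "y \<in> A k"
      then have "real k * q \<xi> y \<le> real l * q \<xi> y"
        using that by (intro mult_right_mono) (auto simp: A_def)
      then show "y \<in> A l"
        using y order_trans[OF _ \<open>real k * q \<xi> y \<le> real l * q \<xi> y\<close>] unfolding A_def by blast
    qed
    then show "incseq (\<lambda>k y. ennreal ((u k y)\<^sup>2))"
      by (auto simp: incseq_def le_fun_def u_def indicator_def)
  qed measurable
  also have "\<dots> \<le> ennreal (\<integral>x. (S x)\<^sup>2 \<partial>P)"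
  proof (rule SUP_least)
    fix k
    have "integrable Q (\<lambda>y. (u k y)\<^sup>2)"
      using power_mono[OF u_bound abs_ge_zero, of k _ 2]
      by (intro Q.integrable_const_bound[where B="(\<Sum>i\<in>UNIV. \<bar>v $ i\<bar> * real k)\<^sup>2"]) auto
    then show "(\<integral>\<^sup>+y. ennreal ((u k y)\<^sup>2) \<partial>Q) \<le> ennreal (\<integral>x. (S x)\<^sup>2 \<partial>P)"
      using u_le by (simp add: nn_integral_eq_integral ennreal_leI)
  qed
  finally show ?thesis
    unfolding P_def Q_def R_def S_def r_def s_def .
qed

text \<open>
  Nonexistent Bochner integrals are 0, so \<open>fisher_info N q \<xi>\<close> has its meaning only after the scores of \<open>q\<close>
  are known to be square integrable; this follows from the bound on the Lebesgue integral above.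
\<close>

lemma fisher_info_postprocessed_le:
  fixes p :: "real^'k::finite \<Rightarrow> 'x \<Rightarrow> real" and q :: "real^'k \<Rightarrow> 'y \<Rightarrow> real" and v :: "real^'k"
  assumes reg: "regular_family M \<Xi> p" and \<phi>: "\<phi> \<in> M \<rightarrow>\<^sub>M prob_algebra N"
    and post: "postprocessed_family M N \<Xi> \<phi> p q" and aeq: "partials_exist_AE N \<Xi> q"
    and \<xi>: "\<xi> \<in> \<Xi>"
  shows "v \<bullet> (fisher_info N q \<xi> *v v) \<le> v \<bullet> (fisher_info M p \<xi> *v v)"
proof -
  have dp: "density_family M \<Xi> p" and aep: "partials_exist_AE M \<Xi> p" and "open \<Xi>"
    using reg by (auto simp: regular_family_def)
  have dq: "density_family N \<Xi> q"
    using post by (simp add: postprocessed_family_def)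
  obtain h where h: "0 < h" and seg: "\<And>i n. \<xi> + (h / real (Suc n)) *\<^sub>R axis i 1 \<in> \<Xi>"
    using axis_segment_in_open[OF \<open>open \<Xi>\<close> \<xi>] by blast
  let ?P = "density M (\<lambda>x. ennreal (p \<xi> x))" and ?Q = "density N (\<lambda>y. ennreal (q \<xi> y))"
  let ?r = "lim_score h q \<xi>" and ?s = "lim_score h p \<xi>"
  have [measurable]: "?r i \<in> borel_measurable N" for i
    by (rule lim_score_measurable[OF dq aeq h seg \<xi>])
  note le = nn_integral_square_score_postprocessed[OF reg \<phi> post aeq \<xi> h seg]
  have r2: "integrable ?Q (\<lambda>y. (?r i y)\<^sup>2)" for i
  proof (rule integrableI_nonneg)
    \<comment> \<open>The direction \<open>axis i 1\<close> isolates one coordinate score; the mixed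
      products below are then dominated by sums of squares.\<close>
    have "(\<Sum>j\<in>UNIV. axis i 1 $ j * ?r j y) = ?r i y" for y
      by (simp add: axis_def if_distrib[of "\<lambda>c. c * _"] cong: if_cong)
    then show "(\<integral>\<^sup>+y. ennreal ((?r i y)\<^sup>2) \<partial>?Q) < \<infinity>"
      using le[of "axis i 1"] by (simp add: order_le_less_trans)
  qed auto
  have rr: "integrable ?Q (\<lambda>y. ?r i y * ?r j y)" for i j
  proof (rule Bochner_Integration.integrable_bound)
    show "integrable ?Q (\<lambda>y. (?r i y)\<^sup>2 + (?r j y)\<^sup>2)" using r2 by simp
    have "\<bar>a * b\<bar> \<le> a\<^sup>2 + b\<^sup>2" for a b :: real
      using sum_squares_bound[of "\<bar>a\<bar>" "\<bar>b\<bar>"] zero_le_power2[of a] zero_le_power2[of b]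
        abs_ge_zero[of "a * b"] unfolding power2_abs abs_mult by linarith
    then show "AE y in ?Q. norm (?r i y * ?r j y) \<le> norm ((?r i y)\<^sup>2 + (?r j y)\<^sup>2)"
      by (intro AE_I2) simp
  qed measurable
  have ss: "integrable ?P (\<lambda>x. ?s i x * ?s j x)" for i j
    unfolding integrable_law_score_iff[OF dp aep h seg \<xi>, symmetric]
    using reg \<xi> by (simp add: regular_family_def)
  have "ennreal (\<integral>y. (\<Sum>i\<in>UNIV. v $ i * ?r i y)\<^sup>2 \<partial>?Q) \<le> ennreal (\<integral>x. (\<Sum>i\<in>UNIV. v $ i * ?s i x)\<^sup>2 \<partial>?P)"
    using le[of v] fisher_info_quadratic_form(1)[OF dq aeq h seg \<xi> rr, of v]
    by (simp add: nn_integral_eq_integral)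
  then show ?thesis
    unfolding fisher_info_quadratic_form(2)[OF dq aeq h seg \<xi> rr]
      fisher_info_quadratic_form(2)[OF dp aep h seg \<xi> ss]
    by (subst (asm) ennreal_le_iff) auto
qed

theorem theorem3p3:
  fixes M :: "'x measure" and N :: "'y measure"
    and \<Xi> :: "(real^'k::finite) set"
    and p :: "real^'k \<Rightarrow> 'x \<Rightarrow> real" and q :: "real^'k \<Rightarrow> 'y \<Rightarrow> real"
    and \<phi> :: "'x \<Rightarrow> 'y measure"
    and \<X> :: "'d set" and par :: "'d multiset \<Rightarrow> real^'k" and \<theta> :: real
  assumes "regular_family M \<Xi> p"
    and "\<forall>D\<in>datasets \<X>. par D \<in> \<Xi>"
    and "rao_private M \<Xi> p \<X> par \<theta>"
    and "\<phi> \<in> M \<rightarrow>\<^sub>M prob_algebra N"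
    and "postprocessed_family M N \<Xi> \<phi> p q"
    and "partials_exist_AE N \<Xi> q"
  shows "rao_private N \<Xi> q \<X> par \<theta>"
proof -
  \<comment> \<open>The embedding \<open>enn2ereal\<close> reflects the order, so the comparison of
    distances carries over to the scale on which the budget is measured.\<close>
  have "enn2ereal (rao_dist N \<Xi> q \<xi>\<^sub>1 \<xi>\<^sub>2) \<le> enn2ereal (rao_dist M \<Xi> p \<xi>\<^sub>1 \<xi>\<^sub>2)" for \<xi>\<^sub>1 \<xi>\<^sub>2
    unfolding less_eq_ennreal.rep_eq[symmetric]
    by (intro rao_dist_mono fisher_info_postprocessed_le[OF assms(1,4,5,6)])
  then show ?thesis
    using assms(3) unfolding rao_private_def by (meson order_trans)
qed

end
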